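(* Let $M$ and $N$ be $\lambda$-terms. Suppose there exist a reduct $N'$ of $N$ and a simple reduct $M'$ of $M$ such that $\mathrm{BT}(M') = \mathrm{BT}(N')$ and there are infinitely many positions $p$ at which both $\mathrm{cBT}(M')$ and $\mathrm{cBT}(N')$ are annotated, with annotations $k_1$ and $k_2$ respectively satisfying $k_1 > k_2$. Then $M \neq_\beta N$.
   Context: Untyped $\lambda$-calculus with $\beta$-reduction; a reduct of $M$ is any $M'$ with $M \twoheadrightarrow_\beta M'$. A redex $(\lambda x.A)B$ is simple if $x$ occurs at most once in $A$ or $B$ is a $\beta$-normal form. A head reduction step is a step $\lambda x_1\ldots x_n.(\lambda y.P)Q Q_1\ldots Q_m \to \lambda x_1\ldots x_n.P[y:=Q] Q_1\ldots Q_m$; a head normal form (hnf) is $\lambda x_1\ldots x_n.\,y M_1\ldots M_m$. A term $t$ is simple (coinductively) if either $t$ has no hnf, or the head reduction of $t$ to hnf $\lambda x_1\ldots x_n.\,y M_1\ldots M_m$ contracts only simple redexes and $M_1,\ldots,M_m$ are simple. The clocked Böhm tree $\mathrm{cBT}(t)$: if $t$ has no hnf, $\mathrm{cBT}(t)=\bot$ (unannotated); otherwise $t$ head-reduces in $k$ steps to an hnf $\lambda x_1\ldots x_n.\,y M_1\ldots M_m$ and $\mathrm{cBT}(t)$ is $\lambda x_1\ldots x_n.\,y\,\mathrm{cBT}(M_1)\ldots\mathrm{cBT}(M_m)$ with root annotated by $k$. $\mathrm{BT}(t)$ is $\mathrm{cBT}(t)$ with annotations erased. Positions are finite sequences over $\{0,1,2\}$.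 *)

theory Defs
  imports Main
begin

datatype trm = Var nat | App trm trm | Abs trm

fun lift :: "nat \<Rightarrow> trm \<Rightarrow> trm" where
  "lift k (Var i) = (if i < k then Var i else Var (Suc i))"
| "lift k (App s t) = App (lift k s) (lift k t)"
| "lift k (Abs s) = Abs (lift (Suc k) s)"

fun subst :: "trm \<Rightarrow> nat \<Rightarrow> trm \<Rightarrow> trm" where
  "subst (Var i) k s = (if k < i then Var (i - 1) else if i = k then s else Var i)"
| "subst (App t u) k s = App (subst t k s) (subst u k s)"
| "subst (Abs t) k s = Abs (subst t (Suc k) (lift 0 s))"

inductive beta :: "trm \<Rightarrow> trm \<Rightarrow> bool" where
  beta_redex: "beta (App (Abs s) t) (subst s 0 t)"
| beta_appL: "beta s s' \<Longrightarrow> beta (App s t) (App s' t)"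
| beta_appR: "beta t t' \<Longrightarrow> beta (App s t) (App s t')"
| beta_abs: "beta s s' \<Longrightarrow> beta (Abs s) (Abs s')"

definition beta_nf :: "trm \<Rightarrow> bool" where
  "beta_nf t \<longleftrightarrow> \<not> (\<exists>t'. beta t t')"

fun occ :: "nat \<Rightarrow> trm \<Rightarrow> nat" where
  "occ k (Var i) = (if i = k then 1 else 0)"
| "occ k (App s t) = occ k s + occ k t"
| "occ k (Abs s) = occ (Suc k) s"

definition simple_redex :: "trm \<Rightarrow> trm \<Rightarrow> bool" where
  "simple_redex A B \<longleftrightarrow> occ 0 A \<le> 1 \<or> beta_nf B"

inductive hstep :: "trm \<Rightarrow> trm \<Rightarrow> bool" where
  hstep_redex: "hstep (App (Abs s) t) (subst s 0 t)"
| hstep_app: "hstep s s' \<Longrightarrow> (\<forall>b. s \<noteq> Abs b) \<Longrightarrow> hstep (App s t) (App s' t)"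
| hstep_abs: "hstep s s' \<Longrightarrow> hstep (Abs s) (Abs s')"

inductive hstep_simple :: "trm \<Rightarrow> trm \<Rightarrow> bool" where
  hs_redex: "simple_redex s t \<Longrightarrow> hstep_simple (App (Abs s) t) (subst s 0 t)"
| hs_app: "hstep_simple s s' \<Longrightarrow> (\<forall>b. s \<noteq> Abs b) \<Longrightarrow> hstep_simple (App s t) (App s' t)"
| hs_abs: "hstep_simple s s' \<Longrightarrow> hstep_simple (Abs s) (Abs s')"

fun is_var_app :: "trm \<Rightarrow> bool" where
  "is_var_app (Var i) = True"
| "is_var_app (App s t) = is_var_app s"
| "is_var_app (Abs s) = False"

fun is_hnf :: "trm \<Rightarrow> bool" where
  "is_hnf (Abs s) = is_hnf s"
| "is_hnf t = is_var_app t"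

fun spine_args :: "trm \<Rightarrow> trm list" where
  "spine_args (App s t) = spine_args s @ [t]"
| "spine_args _ = []"

fun hnf_args :: "trm \<Rightarrow> trm list" where
  "hnf_args (Abs s) = hnf_args s"
| "hnf_args t = spine_args t"

definition has_hnf :: "trm \<Rightarrow> bool" where
  "has_hnf t \<longleftrightarrow> (\<exists>h. hstep\<^sup>*\<^sup>* t h \<and> is_hnf h)"

definition hnf_of :: "trm \<Rightarrow> trm" where
  "hnf_of t = (THE h. hstep\<^sup>*\<^sup>* t h \<and> is_hnf h)"

definition hsteps :: "trm \<Rightarrow> nat" where
  "hsteps t = (THE k. \<exists>h. (hstep ^^ k) t h \<and> is_hnf h)"

coinductive simple_term :: "trm \<Rightarrow> bool" where
  simple_nohnf: "\<not> has_hnf t \<Longrightarrow> simple_term t"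
| simple_hnf: "hstep_simple\<^sup>*\<^sup>* t h \<Longrightarrow> is_hnf h \<Longrightarrow> (\<forall>M \<in> set (hnf_args h). simple_term M)
     \<Longrightarrow> simple_term t"

text \<open>A (clocked) Boehm tree is an infinitary lambda term; positions are lists over {0,1,2}:
  0 = body of an abstraction, 1 = function part of an application, 2 = argument part.
  Each node carries a label and an optional annotation (clock).\<close>

datatype lab = LBot | LVar nat | LAbs | LApp

text \<open>cbt True t p: node of cBT(t) at position p (None if p is not a position of cBT(t)).
  cbt False h p: walks the finite spine of an hnf h, entering cBT(Mi) at arguments.\<close>
function cbt :: "bool \<Rightarrow> trm \<Rightarrow> nat list \<Rightarrow> (lab \<times> nat option) option" where
  "cbt True t p =
     (if has_hnf t then
        (if p = [] then map_option (\<lambda>(l, _). (l, Some (hsteps t))) (cbt False (hnf_of t) [])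
         else cbt False (hnf_of t) p)
      else (if p = [] then Some (LBot, None) else None))"
| "cbt False (Var n) [] = Some (LVar n, None)"
| "cbt False (Abs s) [] = Some (LAbs, None)"
| "cbt False (App s u) [] = Some (LApp, None)"
| "cbt False (Var n) (i # p) = None"
| "cbt False (Abs s) (i # p) = (if i = 0 then cbt False s p else None)"
| "cbt False (App s u) (i # p) =
     (if i = 1 then cbt False s p else if i = 2 then cbt True u p else None)"
  by pat_completeness auto
termination
  by (relation "measure (\<lambda>(b, t, p). 2 * length p + (if b then 1 else 0))") auto

definition cBT :: "trm \<Rightarrow> nat list \<Rightarrow> (lab \<times> nat option) option" where
  "cBT t = cbt True t"

definition BT :: "trm \<Rightarrow> nat list \<Rightarrow> lab option" where
  "BT t p = map_option fst (cBT t p)"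

end

theory Submission
  imports Defs "HOL-Library.Confluence"
begin

text \<open>
  Count reduction steps. Let \<open>M \<rightarrow>\<^sub>h M\<^sub>1\<close> be a head step and \<open>M \<rightarrow>\<^sup>n Z\<close> any reduction. Either the head
  redex is contracted along the way, and then \<open>M\<^sub>1\<close> reduces to \<open>Z\<close>, or it survives, \<open>Z \<rightarrow>\<^sub>h Z\<^sub>1\<close>, and
  \<open>M\<^sub>1\<close> reduces to \<open>Z\<^sub>1\<close>. Hence reduction never increases a clock. If the head step is simple, the new
  reduction has fewer than \<open>n\<close> steps in the first case and at most \<open>n\<close> in the second: the reduction
  of the argument is either empty or performed inside at most one copy, before the reduction of
  the body. So every clock that gets strictly faster uses up one of the \<open>n\<close> steps, and a reduct of
  a simple term differs from it in at most \<open>n\<close> clocks. Given a common reduct \<open>Z\<close> of \<open>M'\<close> and \<open>N'\<close>, at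
  all but finitely many positions the clock of \<open>M'\<close> is that of \<open>Z\<close>, which is at most that of \<open>N'\<close>.
\<close>

section \<open>Substitution and reduction\<close>

declare relpowp.simps(2) [simp del]

lemma lift_lift: "i < Suc k \<Longrightarrow> lift i (lift k t) = lift (Suc k) (lift i t)"
  by (induction t arbitrary: i k) auto

lemma subst_lift [simp]: "subst (lift k t) k s = t"
  by (induction t arbitrary: k s) auto

lemma lift_subst: "j < Suc i \<Longrightarrow> lift i (subst t j s) = subst (lift (Suc i) t) j (lift i s)"
  by (induction t arbitrary: i j s) (auto simp: lift_lift)

lemma lift_subst_le: "i < Suc j \<Longrightarrow> lift i (subst t j s) = subst (lift i t) (Suc j) (lift i s)"
  by (induction t arbitrary: i j s) (auto simp: lift_lift)

text \<open>The substitution lemma in de Bruijn form. As \<open>i \<le> j\<close>, index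
  \<open>j\<close> after the removal of \<open>i\<close> was \<open>Suc j\<close> before it, and
  \<open>v\<close> is lifted past \<open>i\<close>.\<close>

lemma subst_subst:
  "i < Suc j \<Longrightarrow> subst (subst t (Suc j) (lift i v)) i (subst u j v) = subst (subst t i u) j v"
  by (induction t arbitrary: i j u v) (auto simp: lift_lift lift_subst_le)

lemma beta_lift: "beta s t \<Longrightarrow> beta (lift k s) (lift k t)"
  by (induction arbitrary: k rule: beta.induct) (auto simp: lift_subst intro: beta.intros)

lemma beta_subst: "beta s t \<Longrightarrow> beta (subst s k u) (subst t k u)"
proof (induction arbitrary: k u rule: beta.induct)
  case (beta_redex s t)
  then show ?case
    using beta.beta_redex[of "subst s (Suc k) (lift 0 u)" "subst t k u"]
    by (simp add: subst_subst)
qed (auto intro: beta.intros)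

lemma relpowp_map:
  assumes "\<And>x y. R x y \<Longrightarrow> S (f x) (f y)" and "(R ^^ n) x y"
  shows "(S ^^ n) (f x) (f y)"
  using assms(2)
proof (induction n arbitrary: y)
  case (Suc n)
  then show ?case using assms(1) by (auto intro: relpowp_Suc_I elim!: relpowp_Suc_E)
qed simp

lemma beta_relpowp_lift: "(beta ^^ n) s t \<Longrightarrow> (beta ^^ n) (lift k s) (lift k t)"
  by (rule relpowp_map[where R = beta and f = "lift k"]) (rule beta_lift)

lemma beta_relpowp_subst: "(beta ^^ n) s t \<Longrightarrow> (beta ^^ n) (subst s k u) (subst t k u)"
  by (rule relpowp_map[where R = beta and f = "\<lambda>s. subst s k u"]) (rule beta_subst)

lemma beta_relpowp_appL: "(beta ^^ n) s s' \<Longrightarrow> (beta ^^ n) (App s t) (App s' t)"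
  by (rule relpowp_map[where R = beta and f = "\<lambda>s. App s t"]) (rule beta_appL)

lemma beta_relpowp_appR: "(beta ^^ n) t t' \<Longrightarrow> (beta ^^ n) (App s t) (App s t')"
  by (rule relpowp_map[where R = beta and f = "App s"]) (rule beta_appR)

lemma beta_relpowp_abs: "(beta ^^ n) s s' \<Longrightarrow> (beta ^^ n) (Abs s) (Abs s')"
  by (rule relpowp_map[where R = beta and f = Abs]) (rule beta_abs)

lemma beta_relpowp_app:
  "(beta ^^ m) s s' \<Longrightarrow> (beta ^^ n) t t' \<Longrightarrow> (beta ^^ (m + n)) (App s t) (App s' t')"
  using relpowp_trans[OF beta_relpowp_appL beta_relpowp_appR] .

text \<open>Each of the \<open>occ k s\<close> copies of \<open>u\<close> is reduced separately by
  the same \<open>n\<close> steps.\<close>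

lemma beta_relpowp_subst_arg:
  "(beta ^^ n) u u' \<Longrightarrow> (beta ^^ (occ k s * n)) (subst s k u) (subst s k u')"
proof (induction s arbitrary: k u u')
  case (App s t)
  then show ?case by (simp add: add_mult_distrib beta_relpowp_app)
next
  case (Abs s)
  then show ?case by (simp add: beta_relpowp_abs beta_relpowp_lift)
qed auto

lemma beta_rtranclp_app:
  "beta\<^sup>*\<^sup>* s s' \<Longrightarrow> beta\<^sup>*\<^sup>* t t' \<Longrightarrow> beta\<^sup>*\<^sup>* (App s t) (App s' t')"
  by (meson beta_relpowp_app relpowp_imp_rtranclp rtranclp_imp_relpowp)

lemma beta_rtranclp_abs: "beta\<^sup>*\<^sup>* s s' \<Longrightarrow> beta\<^sup>*\<^sup>* (Abs s) (Abs s')"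
  by (meson beta_relpowp_abs relpowp_imp_rtranclp rtranclp_imp_relpowp)

lemma beta_rtranclp_subst:
  "beta\<^sup>*\<^sup>* s s' \<Longrightarrow> beta\<^sup>*\<^sup>* t t' \<Longrightarrow> beta\<^sup>*\<^sup>* (subst s k t) (subst s' k t')"
  by (meson beta_relpowp_subst beta_relpowp_subst_arg relpowp_imp_rtranclp rtranclp_imp_relpowp
      rtranclp_trans)

section \<open>Inversion of counted reductions\<close>

inductive_cases beta_AbsE: "beta (Abs s) t"

lemma beta_relpowp_AbsD: "(beta ^^ n) (Abs s) t \<Longrightarrow> \<exists>s'. t = Abs s' \<and> (beta ^^ n) s s'"
proof (induction n arbitrary: t)
  case (Suc n)
  then show ?case by (blast elim: relpowp_Suc_E beta_AbsE intro: relpowp_Suc_I)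
qed simp

lemma beta_rtranclp_AbsD: "beta\<^sup>*\<^sup>* (Abs s) (Abs s') \<Longrightarrow> beta\<^sup>*\<^sup>* s s'"
  by (metis beta_relpowp_AbsD relpowp_imp_rtranclp rtranclp_imp_relpowp trm.inject(3))

text \<open>Split at the first contraction of the root: before it, every step lies in the function
  or in the argument. The \<open>Suc\<close> counts the root contraction.\<close>

lemma beta_relpowp_AppD:
  assumes "(beta ^^ n) (App s t) u"
  shows "(\<exists>s' t' a b. u = App s' t' \<and> (beta ^^ a) s s' \<and> (beta ^^ b) t t' \<and> n = a + b) \<or>
    (\<exists>r t' a b c. (beta ^^ a) s (Abs r) \<and> (beta ^^ b) t t' \<and> (beta ^^ c) (subst r 0 t') u \<and>
       n = Suc (a + b + c))"
  using assms
proof (induction n arbitrary: u)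
  case 0
  have "u = App s t \<and> (beta ^^ 0) s s \<and> (beta ^^ 0) t t \<and> 0 = 0 + (0::nat)" using 0 by simp
  then show ?case by blast
next
  case (Suc n)
  then obtain v where v: "(beta ^^ n) (App s t) v" "beta v u" by (blast elim: relpowp_Suc_E)
  from Suc.IH[OF v(1)] show ?case
  proof (elim disjE exE conjE)
    fix s' t' a b
    assume *: "v = App s' t'" "(beta ^^ a) s s'" "(beta ^^ b) t t'" "n = a + b"
    from v(2)[unfolded *(1)] show ?thesis
    proof (cases rule: beta.cases)
      case (beta_redex r)
      then have "(beta ^^ a) s (Abs r) \<and> (beta ^^ b) t t' \<and> (beta ^^ 0) (subst r 0 t') u \<and>
        Suc n = Suc (a + b + 0)" using * by simp
      then show ?thesis by blast
    next
      case (beta_appL s'')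
      then have "u = App s'' t' \<and> (beta ^^ Suc a) s s'' \<and> (beta ^^ b) t t' \<and> Suc n = Suc a + b"
        using * by (auto intro: relpowp_Suc_I)
      then show ?thesis by blast
    next
      case (beta_appR t'')
      then have "u = App s' t'' \<and> (beta ^^ a) s s' \<and> (beta ^^ Suc b) t t'' \<and> Suc n = a + Suc b"
        using * by (auto intro: relpowp_Suc_I)
      then show ?thesis by blast
    qed
  next
    fix r t' a b c
    assume *: "(beta ^^ a) s (Abs r)" "(beta ^^ b) t t'" "(beta ^^ c) (subst r 0 t') v"
      "n = Suc (a + b + c)"
    have "(beta ^^ Suc c) (subst r 0 t') u \<and> Suc n = Suc (a + b + Suc c)"
      using relpowp_Suc_I[OF *(3) v(2)] *(4) by simp
    then show ?thesis using * by blast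
  qed
qed

section \<open>Confluence\<close>

text \<open>Complete development: contracts all redexes present in the term, but none that are
  created on the way.\<close>

fun dev :: "trm \<Rightarrow> trm" where
  "dev (Var n) = Var n"
| "dev (Abs s) = Abs (dev s)"
| "dev (App (Abs s) t) = subst (dev s) 0 (dev t)"
| "dev (App s t) = App (dev s) (dev t)"

lemma beta_rtranclp_dev: "beta\<^sup>*\<^sup>* s (dev s)"
proof (induction s rule: dev.induct)
  case (3 s t)
  then show ?case
    by (auto intro: converse_rtranclp_into_rtranclp[of beta, OF beta_redex] beta_rtranclp_subst)
qed (auto intro: beta_rtranclp_app beta_rtranclp_abs)

text \<open>The two terms differ only when \<open>s\<close> is an abstraction, and then by one root
  step.\<close>

lemma App_dev: "beta\<^sup>*\<^sup>* (App (dev s) (dev t)) (dev (App s t))"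
  by (cases s) (auto intro: beta_redex)

lemma dev_lift: "dev (lift k s) = lift k (dev s)"
  by (induction s arbitrary: k rule: dev.induct) (auto simp: lift_subst)

text \<open>Only a reduction and not an equation: an abstraction \<open>u\<close> substituted for a
  variable in function position creates redexes, which the development on the right
  contracts.\<close>

lemma subst_dev: "beta\<^sup>*\<^sup>* (subst (dev s) k (dev u)) (dev (subst s k u))"
proof (induction s arbitrary: k u rule: dev.induct)
  case (2 s)
  then show ?case by (auto simp: dev_lift[symmetric] intro: beta_rtranclp_abs)
next
  case (3 s t)
  then show ?case
    by (auto simp: subst_subst[symmetric] dev_lift[symmetric] intro: beta_rtranclp_subst)
next
  case ("4_1" v t)
  have "beta\<^sup>*\<^sup>* (subst (dev (App (Var v) t)) k (dev u))
     (App (dev (subst (Var v) k u)) (dev (subst t k u)))"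
    using "4_1" by (auto intro: beta_rtranclp_app)
  then show ?case using App_dev by (metis (lifting) rtranclp_trans subst.simps(2))
next
  case ("4_2" v va t)
  have "beta\<^sup>*\<^sup>* (subst (dev (App (App v va) t)) k (dev u))
     (App (dev (subst (App v va) k u)) (dev (subst t k u)))"
    using "4_2" by (auto intro: beta_rtranclp_app)
  then show ?case using App_dev by (metis (lifting) rtranclp_trans subst.simps(2))
qed auto

text \<open>The Z property of Dehornoy and van Oostrom.\<close>

lemma beta_Z: "beta s t \<Longrightarrow> beta\<^sup>*\<^sup>* t (dev s) \<and> beta\<^sup>*\<^sup>* (dev s) (dev t)"
proof (induction rule: beta.induct)
  case (beta_redex s t)
  then show ?case by (auto intro: beta_rtranclp_subst beta_rtranclp_dev subst_dev)
next
  case (beta_appL s s' t)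
  have 1: "beta\<^sup>*\<^sup>* (App s' t) (dev (App s t))"
    using beta_appL App_dev beta_rtranclp_app beta_rtranclp_dev by (meson rtranclp_trans)
  have 2: "beta\<^sup>*\<^sup>* (App (dev s) (dev t)) (dev (App s' t))"
    using beta_appL App_dev beta_rtranclp_app by (meson rtranclp_trans rtranclp.rtrancl_refl)
  have "beta\<^sup>*\<^sup>* (dev (App s t)) (dev (App s' t))"
  proof (cases s)
    \<comment> \<open>For any other \<open>s\<close> the development of \<open>App s t\<close> is an
      application and \<open>2\<close> suffices. Here the root redex is contracted on both sides, as
      \<open>s'\<close> is an abstraction too.\<close>
    case (Abs r)
    then obtain r' where r': "s' = Abs r'" using beta_appL by (auto elim: beta_AbsE)
    then have "beta\<^sup>*\<^sup>* (dev r) (dev r')" using Abs beta_appL by (auto dest: beta_rtranclp_AbsD)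
    then show ?thesis using Abs r' by (auto intro: beta_rtranclp_subst)
  qed (use 2 in auto)
  with 1 show ?case ..
next
  case (beta_appR t t' s)
  have 1: "beta\<^sup>*\<^sup>* (App s t') (dev (App s t))"
    using beta_appR App_dev beta_rtranclp_app beta_rtranclp_dev by (meson rtranclp_trans)
  have "beta\<^sup>*\<^sup>* (dev (App s t)) (dev (App s t'))"
    using beta_appR by (cases s) (auto intro: beta_rtranclp_subst beta_rtranclp_app)
  with 1 show ?case ..
next
  case (beta_abs s s')
  then show ?case by (auto intro: beta_rtranclp_abs)
qed

lemma dev_mono: "beta\<^sup>*\<^sup>* s t \<Longrightarrow> beta\<^sup>*\<^sup>* (dev s) (dev t)"
  by (induction rule: rtranclp_induct) (auto dest: beta_Z)

text \<open>If \<open>a\<close> reduces to \<open>c'\<close> and \<open>c'\<close> steps to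
  \<open>c\<close>, then \<open>dev c'\<close> is a common reduct: \<open>c\<close> reaches it by
  the Z property, \<open>b\<close> through \<open>dev a\<close>.\<close>

lemma semiconfluentp_beta: "semiconfluentp beta"
proof (rule semiconfluentpI)
  fix a b c assume "beta a b" "beta\<^sup>*\<^sup>* a c"
  from this(2) show "\<exists>d. beta\<^sup>*\<^sup>* b d \<and> beta\<^sup>*\<^sup>* c d"
  proof (cases rule: rtranclp.cases)
    case rtrancl_refl
    then show ?thesis using \<open>beta a b\<close> by auto
  next
    case (rtrancl_into_rtrancl c')
    then have "beta\<^sup>*\<^sup>* b (dev c')" "beta\<^sup>*\<^sup>* c (dev c')"
      using beta_Z \<open>beta a b\<close> dev_mono by (meson rtranclp_trans)+
    then show ?thesis by blast
  qed
qed

lemma equivclp_beta_joinable: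
  assumes "equivclp beta s t" shows "\<exists>u. beta\<^sup>*\<^sup>* s u \<and> beta\<^sup>*\<^sup>* t u"
  using assms unfolding semiconfluentp_equivclp[OF semiconfluentp_beta]
  by (auto simp: rtranclp_conversep)

section \<open>Head reduction\<close>

inductive_cases hstep_VarE: "hstep (Var n) t"
inductive_cases hstep_AbsE: "hstep (Abs s) t"
inductive_cases hstep_AppE: "hstep (App s t) u"

lemma hstep_deterministic: "hstep s t \<Longrightarrow> hstep s t' \<Longrightarrow> t = t'"
proof (induction arbitrary: t' rule: hstep.induct)
  case (hstep_redex s t)
  from hstep_redex.prems show ?case by (rule hstep_AppE) (auto elim: hstep_AbsE)
next
  case (hstep_app s s' t)
  from hstep_app.prems show ?case
    by (rule hstep_AppE) (use hstep_app.hyps hstep_app.IH in blast)+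
next
  case (hstep_abs s s')
  from hstep_abs.prems show ?case by (rule hstep_AbsE) (use hstep_abs.IH in blast)
qed

lemma hstep_simple_imp_hstep: "hstep_simple s t \<Longrightarrow> hstep s t"
  by (induction rule: hstep_simple.induct) (auto intro: hstep.intros)

lemma is_var_app_no_hstep: "is_var_app s \<Longrightarrow> \<not> hstep s t"
  by (induction s arbitrary: t) (auto elim!: hstep_VarE hstep_AppE)

lemma is_hnf_no_hstep: "is_hnf s \<Longrightarrow> \<not> hstep s t"
proof (induction s arbitrary: t)
  case (App s u)
  then show ?case using is_var_app_no_hstep[of "App s u"] by simp
qed (auto elim!: hstep_VarE hstep_AbsE)

text \<open>Head reduction is deterministic and stops at an hnf. This makes the definite
  descriptions in \<open>hnf_of\<close> and \<open>hsteps\<close> meaningful.\<close>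

lemma hstep_relpowp_hnf_unique:
  "(hstep ^^ k) s h \<Longrightarrow> (hstep ^^ k') s h' \<Longrightarrow> is_hnf h \<Longrightarrow> is_hnf h' \<Longrightarrow> k = k' \<and> h = h'"
proof (induction k arbitrary: s k')
  case 0
  then show ?case by (cases k') (auto dest: relpowp_Suc_D2 is_hnf_no_hstep)
next
  case (Suc k)
  show ?case
  proof (cases k')
    case 0
    then show ?thesis using Suc.prems by (auto dest: relpowp_Suc_D2 is_hnf_no_hstep)
  next
    case (Suc l)
    then show ?thesis using Suc.prems Suc.IH by (metis relpowp_Suc_D2 hstep_deterministic)
  qed
qed

lemma hnf_clock:
  assumes "(hstep ^^ k) s h" "is_hnf h"
  shows "has_hnf s" "hnf_of s = h" "hsteps s = k"
proof -
  have steps: "hstep\<^sup>*\<^sup>* s h" by (rule relpowp_imp_rtranclp[OF assms(1)])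
  then show "has_hnf s" using assms(2) unfolding has_hnf_def by blast
  have "h' = h" if "hstep\<^sup>*\<^sup>* s h'" "is_hnf h'" for h'
    using rtranclp_imp_relpowp[OF that(1)] hstep_relpowp_hnf_unique[OF assms(1) _ assms(2) that(2)]
    by blast
  then show "hnf_of s = h" using steps assms(2) unfolding hnf_of_def by blast
  show "hsteps s = k"
    using assms hstep_relpowp_hnf_unique unfolding hsteps_def by (intro the_equality) blast+
qed

lemma has_hnf_relpowp: "has_hnf s \<Longrightarrow> \<exists>k h. (hstep ^^ k) s h \<and> is_hnf h"
  unfolding has_hnf_def using rtranclp_imp_relpowp[of hstep] by blast

section \<open>Reducts of head normal forms\<close>

lemma is_var_app_is_hnf: "is_var_app s \<Longrightarrow> is_hnf s"
  by (cases s) auto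

lemma is_var_app_hnf_args: "is_var_app s \<Longrightarrow> hnf_args s = spine_args s"
  by (cases s) auto

lemma is_var_app_beta: "beta s t \<Longrightarrow> is_var_app s \<Longrightarrow> is_var_app t"
  by (induction rule: beta.induct) auto

lemma is_var_app_beta_relpowp: "(beta ^^ n) s t \<Longrightarrow> is_var_app s \<Longrightarrow> is_var_app t"
  by (induction n arbitrary: t) (auto intro: is_var_app_beta elim!: relpowp_Suc_E)

lemma is_hnf_beta: "beta s t \<Longrightarrow> is_hnf s \<Longrightarrow> is_hnf t"
  by (induction rule: beta.induct) (auto dest: is_var_app_beta)

lemma is_hnf_beta_relpowp: "(beta ^^ n) s t \<Longrightarrow> is_hnf s \<Longrightarrow> is_hnf t"
  by (induction n arbitrary: t) (auto intro: is_hnf_beta elim!: relpowp_Suc_E)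

text \<open>A contraction of the root would need \<open>s\<close> to reduce to an abstraction, but
  all reducts of \<open>s\<close> stay headed by a variable.\<close>

lemma beta_relpowp_var_appD:
  assumes "(beta ^^ n) (App s t) u" "is_var_app s"
  shows "\<exists>s' t' a b. u = App s' t' \<and> (beta ^^ a) s s' \<and> (beta ^^ b) t t' \<and> n = a + b"
  using beta_relpowp_AppD[OF assms(1)] is_var_app_beta_relpowp[OF _ assms(2)] by fastforce

section \<open>Reducts of head reductions\<close>

inductive_cases hstep_simple_AppE: "hstep_simple (App s t) u"
inductive_cases hstep_simple_AbsE: "hstep_simple (Abs s) u"

text \<open>A normal \<open>t\<close> forces \<open>b = 0\<close>; otherwise there is at most one
  copy of \<open>t\<close>.\<close>

lemma simple_redex_steps:
  assumes "simple_redex s t" "(beta ^^ b) t t'"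
  shows "occ 0 s * b \<le> b"
proof (cases b)
  case (Suc c)
  then have "\<not> beta_nf t" using assms(2) unfolding beta_nf_def by (blast dest: relpowp_Suc_D2)
  then have "occ 0 s \<le> 1" using assms(1) unfolding simple_redex_def by blast
  then show ?thesis using mult_le_mono1[of "occ 0 s" 1 b] by simp
qed simp

text \<open>The argument is reduced first: its copies are then counted in \<open>s\<close>, where
  simplicity bounds them, and not in \<open>s'\<close>, where reduction may have multiplied the
  occurrences of the bound variable.\<close>

lemma beta_relpowp_contractum:
  assumes "(beta ^^ a) s s'" "(beta ^^ b) t t'"
  shows "\<exists>m. (beta ^^ m) (subst s 0 t) (subst s' 0 t') \<and> (simple_redex s t \<longrightarrow> m \<le> a + b)"
proof -
  have "(beta ^^ (occ 0 s * b + a)) (subst s 0 t) (subst s' 0 t')"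
    using relpowp_trans[OF beta_relpowp_subst_arg[OF assms(2)] beta_relpowp_subst[OF assms(1)]] .
  moreover have "simple_redex s t \<longrightarrow> occ 0 s * b + a \<le> a + b"
    using simple_redex_steps[OF _ assms(2)] by simp
  ultimately show ?thesis by blast
qed

definition is_Abs :: "trm \<Rightarrow> bool" where
  "is_Abs s \<longleftrightarrow> (\<exists>b. s = Abs b)"

text \<open>The clause on \<open>is_Abs\<close> makes the second alternative stable under application: a head redex
  that survives under an application cannot have become hidden below an abstraction.\<close>

lemma hstep_beta_relpowp:
  assumes "hstep s s1" "(beta ^^ n) s z"
  shows "(\<exists>m. (beta ^^ m) s1 z \<and> (hstep_simple s s1 \<longrightarrow> m < n)) \<or>
    (\<exists>m z1. hstep z z1 \<and> (beta ^^ m) s1 z1 \<and> (hstep_simple s s1 \<longrightarrow> m \<le> n) \<and>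
       (is_Abs z \<longrightarrow> is_Abs s))"
  using assms
proof (induction arbitrary: n z rule: hstep.induct)
  case (hstep_redex s t)
  have simple: "simple_redex s t" if "hstep_simple (App (Abs s) t) (subst s 0 t)"
    using that by (auto elim: hstep_simple_AppE)
  from beta_relpowp_AppD[OF hstep_redex] show ?case
  proof (elim disjE exE conjE)
    fix r t' a b assume *: "z = App r t'" "(beta ^^ a) (Abs s) r" "(beta ^^ b) t t'" "n = a + b"
    then obtain s' where s': "r = Abs s'" "(beta ^^ a) s s'" using beta_relpowp_AbsD by blast
    obtain m where "(beta ^^ m) (subst s 0 t) (subst s' 0 t')" "simple_redex s t \<longrightarrow> m \<le> n"
      using beta_relpowp_contractum[OF s'(2) *(3)] *(4) by blast
    moreover have "hstep z (subst s' 0 t')" using *(1) s'(1) by (simp add: hstep.hstep_redex)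
    moreover have "\<not> is_Abs z" using *(1) by (simp add: is_Abs_def)
    ultimately show ?thesis using simple by blast
  next
    fix s' t' a b c
    assume *: "(beta ^^ a) (Abs s) (Abs s')" "(beta ^^ b) t t'" "(beta ^^ c) (subst s' 0 t') z"
      "n = Suc (a + b + c)"
    then have "(beta ^^ a) s s'" using beta_relpowp_AbsD by blast
    then obtain m where m: "(beta ^^ m) (subst s 0 t) (subst s' 0 t')"
        "simple_redex s t \<longrightarrow> m \<le> a + b"
      using beta_relpowp_contractum *(2) by blast
    have "(beta ^^ (m + c)) (subst s 0 t) z" using relpowp_trans[OF m(1) *(3)] .
    \<comment> \<open>The root contraction, counted by the \<open>Suc\<close> in \<open>n\<close>,
      is the step saved: the head step has already performed it.\<close>
    moreover have "simple_redex s t \<longrightarrow> m + c < n" using m(2) *(4) by auto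
    ultimately show ?thesis using simple by blast
  qed
next
  case (hstep_app s s' t)
  have simple: "hstep_simple s s'" if "hstep_simple (App s t) (App s' t)"
    using that hstep_app.hyps(2) by (auto elim: hstep_simple_AppE)
  from beta_relpowp_AppD[OF hstep_app.prems] show ?case
  proof (elim disjE exE conjE)
    fix r t' a b assume *: "z = App r t'" "(beta ^^ a) s r" "(beta ^^ b) t t'" "n = a + b"
    from hstep_app.IH[OF *(2)] show ?thesis
    proof (elim disjE exE conjE)
      fix m assume m: "(beta ^^ m) s' r" "hstep_simple s s' \<longrightarrow> m < a"
      have "(beta ^^ (m + b)) (App s' t) z" using beta_relpowp_app[OF m(1) *(3)] *(1) by simp
      moreover have "hstep_simple s s' \<longrightarrow> m + b < n" using m(2) *(4) by auto
      ultimately show ?thesis using simple by blast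
    next
      fix m r1
      assume m: "hstep r r1" "(beta ^^ m) s' r1" "hstep_simple s s' \<longrightarrow> m \<le> a"
        "is_Abs r \<longrightarrow> is_Abs s"
      have "(beta ^^ (m + b)) (App s' t) (App r1 t')" using beta_relpowp_app[OF m(2) *(3)] .
      moreover have "hstep_simple s s' \<longrightarrow> m + b \<le> n" using m(3) *(4) by auto
      \<comment> \<open>As \<open>s\<close> is no abstraction, neither is \<open>r\<close>, so the
        head step of \<open>r\<close> is also one of \<open>App r t'\<close>.\<close>
      moreover have "hstep z (App r1 t')"
        using m(1,4) *(1) hstep_app.hyps(2) by (auto simp: is_Abs_def intro: hstep.hstep_app)
      moreover have "\<not> is_Abs z" using *(1) by (simp add: is_Abs_def)
      ultimately show ?thesis using simple by blast
    qed
  next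
    fix r t' a b c
    assume *: "(beta ^^ a) s (Abs r)" "(beta ^^ b) t t'" "(beta ^^ c) (subst r 0 t') z"
      "n = Suc (a + b + c)"
    \<comment> \<open>The head redex of \<open>s\<close> cannot have survived: \<open>s\<close> is
      no abstraction while its reduct \<open>Abs r\<close> is one.\<close>
    obtain m where m: "(beta ^^ m) s' (Abs r)" "hstep_simple s s' \<longrightarrow> m < a"
      using hstep_app.IH[OF *(1)] hstep_app.hyps(2) by (auto simp: is_Abs_def)
    have "(beta ^^ (Suc (m + b) + c)) (App s' t) z"
      using relpowp_trans[OF relpowp_Suc_I[OF beta_relpowp_app[OF m(1) *(2)] beta_redex] *(3)] .
    moreover have "hstep_simple s s' \<longrightarrow> Suc (m + b) + c < n" using m(2) *(4) by auto
    ultimately show ?thesis using simple by blast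
  qed
next
  case (hstep_abs s s')
  have simple: "hstep_simple s s'" if "hstep_simple (Abs s) (Abs s')"
    using that by (auto elim: hstep_simple_AbsE)
  obtain r where r: "z = Abs r" "(beta ^^ n) s r"
    using beta_relpowp_AbsD[OF hstep_abs.prems] by blast
  have "is_Abs (Abs s)" by (simp add: is_Abs_def)
  with hstep_abs.IH[OF r(2)] show ?case
    using simple r(1) beta_relpowp_abs hstep.hstep_abs by blast
qed

text \<open>Each head step either disappears, which uses up a step of the reduction if it is simple,
  or survives and adds one to \<open>j\<close>. The inequality says
  \<open>m \<le> n - (k - j)\<close> without truncated subtraction: the gain in clock is paid out of
  \<open>n\<close>.\<close>

lemma hstep_relpowp_beta_relpowp:
  assumes "(hstep ^^ k) s h" "is_hnf h" "(beta ^^ n) s z"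
  shows "\<exists>j hz m. j \<le> k \<and> (hstep ^^ j) z hz \<and> is_hnf hz \<and> (beta ^^ m) h hz \<and>
    ((hstep_simple ^^ k) s h \<longrightarrow> m + k \<le> n + j)"
  using assms
proof (induction k arbitrary: s n z)
  case 0
  have "(0::nat) \<le> 0 \<and> (hstep ^^ 0) z z \<and> is_hnf z \<and> (beta ^^ n) h z \<and> n + 0 \<le> n + (0::nat)"
    using 0 is_hnf_beta_relpowp by auto
  then show ?case by blast
next
  case (Suc k)
  then obtain s1 where s1: "hstep s s1" "(hstep ^^ k) s1 h" by (blast dest: relpowp_Suc_D2)
  \<comment> \<open>A simple head reduction takes the same first step, since head reduction is
    deterministic.\<close>
  have simple: "hstep_simple s s1 \<and> (hstep_simple ^^ k) s1 h" if "(hstep_simple ^^ Suc k) s h"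
    using relpowp_Suc_D2[OF that] hstep_deterministic[OF s1(1)] hstep_simple_imp_hstep by blast
  from hstep_beta_relpowp[OF s1(1) Suc.prems(3)] show ?case
  proof (elim disjE exE conjE)
    fix m assume m: "(beta ^^ m) s1 z" "hstep_simple s s1 \<longrightarrow> m < n"
    obtain j hz m' where "j \<le> k" "(hstep ^^ j) z hz" "is_hnf hz" "(beta ^^ m') h hz"
        "(hstep_simple ^^ k) s1 h \<longrightarrow> m' + k \<le> m + j"
      using Suc.IH[OF s1(2) Suc.prems(2) m(1)] by blast
    moreover from this have "(hstep_simple ^^ Suc k) s h \<longrightarrow> m' + Suc k \<le> n + j"
      using simple m(2) by fastforce
    ultimately show ?thesis using le_SucI by blast
  next
    fix m z1
    assume m: "hstep z z1" "(beta ^^ m) s1 z1" "hstep_simple s s1 \<longrightarrow> m \<le> n"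
    obtain j hz m' where "j \<le> k" "(hstep ^^ j) z1 hz" "is_hnf hz" "(beta ^^ m') h hz"
        "(hstep_simple ^^ k) s1 h \<longrightarrow> m' + k \<le> m + j"
      using Suc.IH[OF s1(2) Suc.prems(2) m(2)] by blast
    moreover from this have "(hstep_simple ^^ Suc k) s h \<longrightarrow> m' + Suc k \<le> n + Suc j"
      using simple m(3) by fastforce
    moreover from calculation have "Suc j \<le> Suc k \<and> (hstep ^^ Suc j) z hz"
      using m(1) by (blast intro: relpowp_Suc_I2)
    ultimately show ?thesis by blast
  qed
qed

section \<open>Clocks\<close>

declare cbt.simps(1) [simp del]

lemma cbt_hnf_Nil_Some: "\<exists>l. cbt False s [] = Some (l, None)"
  by (cases s) auto

lemma cbt_hnf:
  assumes "(hstep ^^ k) s h" "is_hnf h"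
  shows "p \<noteq> [] \<Longrightarrow> cbt True s p = cbt False h p"
    and "\<exists>l. cbt True s [] = Some (l, Some k)"
  using hnf_clock[OF assms] cbt_hnf_Nil_Some[of h] by (auto simp: cbt.simps(1))

lemma cbt_annot_has_hnf: "cbt True s p = Some (l, Some k) \<Longrightarrow> has_hnf s"
  by (auto simp: cbt.simps(1) split: if_splits)

text \<open>Induction along \<open>cbt\<close>. At a root, the comparison of head reductions bounds
  the new clock and links the two hnfs by a reduction; on the spine of an hnf, a reduction splits
  into reductions of the parts.\<close>

lemma cbt_accelerates:
  assumes "(beta ^^ n) s z" "cbt b s p = Some (l, Some k)" "\<not> b \<Longrightarrow> is_hnf s"
  shows "\<exists>l' k'. cbt b z p = Some (l', Some k') \<and> k' \<le> k"
  using assms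
proof (induction b s p arbitrary: n z rule: cbt.induct)
  case (1 t p)
  from cbt_annot_has_hnf[OF 1(4)] obtain i h where h: "(hstep ^^ i) t h" "is_hnf h"
    using has_hnf_relpowp by blast
  obtain j hz m where z: "j \<le> i" "(hstep ^^ j) z hz" "is_hnf hz" "(beta ^^ m) h hz"
    using hstep_relpowp_beta_relpowp[OF h 1(3)] by blast
  show ?case
  proof (cases "p = []")
    case True
    then show ?thesis using cbt_hnf[OF h] cbt_hnf[OF z(2,3)] z(1) 1(4) by auto
  next
    case False
    then show ?thesis using 1(2)[of m hz] cbt_hnf[OF h] cbt_hnf[OF z(2,3)] hnf_clock[OF h] z h 1(4)
      by auto
  qed
next
  case (6 s i p)
  obtain r where "z = Abs r" "(beta ^^ n) s r" using beta_relpowp_AbsD[OF 6(2)] by blast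
  then show ?case using 6 by (auto split: if_splits)
next
  case (7 s u i p)
  have s: "is_var_app s" using 7 by auto
  obtain s' u' a b where "z = App s' u'" "(beta ^^ a) s s'" "(beta ^^ b) u u'"
    using beta_relpowp_var_appD[OF 7(3) s] by blast
  then show ?case using 7 is_var_app_is_hnf[OF s] by (auto split: if_splits)
qed auto

section \<open>Counting the positions at which a clock changes\<close>

text \<open>The depth bound \<open>d\<close> provides an induction, as \<open>simple_term\<close> is
  coinductive and the trees may be infinite.\<close>

definition clock_diff :: "bool \<Rightarrow> trm \<Rightarrow> trm \<Rightarrow> nat \<Rightarrow> nat list set" where
  "clock_diff b s z d =
     {p. length p < d \<and> (\<exists>l k. cbt b s p = Some (l, Some k) \<and> (\<forall>l'. cbt b z p \<noteq> Some (l', Some k)))}"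

lemma clock_diff_hnf_Var: "clock_diff False (Var i) z d = {}"
proof -
  have "cbt False (Var i) p \<noteq> Some (l, Some k)" for p l k by (cases p) auto
  then show ?thesis by (simp add: clock_diff_def)
qed

lemma clock_diff_hnf_Abs:
  "clock_diff False (Abs s) (Abs z) (Suc d) \<subseteq> Cons 0 ` clock_diff False s z d"
proof
  fix p assume "p \<in> clock_diff False (Abs s) (Abs z) (Suc d)"
  then show "p \<in> Cons 0 ` clock_diff False s z d"
    by (cases p) (auto simp: clock_diff_def split: if_splits)
qed

lemma clock_diff_hnf_App:
  "clock_diff False (App s u) (App z v) (Suc d) \<subseteq>
     Cons 1 ` clock_diff False s z d \<union> Cons 2 ` clock_diff True u v d"
proof
  fix p assume "p \<in> clock_diff False (App s u) (App z v) (Suc d)"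
  then show "p \<in> Cons 1 ` clock_diff False s z d \<union> Cons 2 ` clock_diff True u v d"
    by (cases p) (auto simp: clock_diff_def split: if_splits)
qed

lemma clock_diff_head:
  assumes "(hstep ^^ k) s h" "is_hnf h" "(hstep ^^ j) z hz" "is_hnf hz"
  shows "clock_diff True s z d \<subseteq> (if j = k then {} else {[]}) \<union> clock_diff False h hz d"
proof
  fix p assume "p \<in> clock_diff True s z d"
  then show "p \<in> (if j = k then {} else {[]}) \<union> clock_diff False h hz d"
    using cbt_hnf[OF assms(1,2)] cbt_hnf[OF assms(3,4)]
    by (cases "p = []") (auto simp: clock_diff_def)
qed

text \<open>The \<open>n\<close> steps are a budget: the parts of an hnf share it, and a root whose
  clock changes spends at least one step. Finiteness is carried along because \<open>card\<close> is
  \<open>0\<close> on infinite sets.\<close>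

lemma clock_diff_bound:
  "(simple_term s \<longrightarrow> (beta ^^ n) s z \<longrightarrow>
      finite (clock_diff True s z d) \<and> card (clock_diff True s z d) \<le> n) \<and>
   (is_hnf s \<longrightarrow> (\<forall>a \<in> set (hnf_args s). simple_term a) \<longrightarrow> (beta ^^ n) s z \<longrightarrow>
      finite (clock_diff False s z d) \<and> card (clock_diff False s z d) \<le> n)"
proof (induction d arbitrary: s n z)
  case 0
  then show ?case by (simp add: clock_diff_def)
next
  case (Suc d)
  \<comment> \<open>Comes first since a term and its hnf are compared at the same depth
    \<open>Suc d\<close>; only passing to a part lowers the depth.\<close>
  have hnf: "finite (clock_diff False s z (Suc d)) \<and> card (clock_diff False s z (Suc d)) \<le> n"
    if hyps: "is_hnf s" "\<forall>a \<in> set (hnf_args s). simple_term a" "(beta ^^ n) s z" for s n z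
  proof (cases s)
    case (Var i)
    then show ?thesis by (simp add: clock_diff_hnf_Var)
  next
    case (Abs r)
    then obtain r' where r': "z = Abs r'" "(beta ^^ n) r r'" using hyps beta_relpowp_AbsD by blast
    let ?D = "clock_diff False r r' d"
    have D: "finite ?D" "card ?D \<le> n" using Suc.IH[of r n r'] hyps r' Abs by auto
    have sub: "clock_diff False s z (Suc d) \<subseteq> Cons 0 ` ?D"
      using clock_diff_hnf_Abs Abs r' by simp
    have "card (clock_diff False s z (Suc d)) \<le> card (Cons 0 ` ?D)"
      using card_mono[OF _ sub] D by simp
    also have "\<dots> \<le> card ?D" by (rule card_image_le[OF D(1)])
    finally show ?thesis using D finite_subset[OF sub] by simp
  next
    case (App r u)
    then have r: "is_var_app r" using hyps by simp
    obtain r' u' a b where r': "z = App r' u'" "(beta ^^ a) r r'" "(beta ^^ b) u u'" "n = a + b"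
      using beta_relpowp_var_appD[OF _ r] hyps(3) App by blast
    let ?D = "clock_diff False r r' d" and ?E = "clock_diff True u u' d"
    have D: "finite ?D" "card ?D \<le> a"
      using Suc.IH[of r a r'] hyps r' App is_var_app_is_hnf[OF r] is_var_app_hnf_args[OF r] by auto
    have E: "finite ?E" "card ?E \<le> b" using Suc.IH[of u b u'] hyps r' App by auto
    have sub: "clock_diff False s z (Suc d) \<subseteq> Cons 1 ` ?D \<union> Cons 2 ` ?E"
      using clock_diff_hnf_App App r' by simp
    have "card (clock_diff False s z (Suc d)) \<le> card (Cons 1 ` ?D \<union> Cons 2 ` ?E)"
      using card_mono[OF _ sub] D E by simp
    also have "\<dots> \<le> card (Cons 1 ` ?D) + card (Cons 2 ` ?E)" by (rule card_Un_le)
    also have "\<dots> \<le> card ?D + card ?E" using D E by (intro add_mono card_image_le)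
    finally show ?thesis using D E r'(4) finite_subset[OF sub] by simp
  qed
  have "finite (clock_diff True s z (Suc d)) \<and> card (clock_diff True s z (Suc d)) \<le> n"
    if hyps: "simple_term s" "(beta ^^ n) s z" for s n z
    using hyps(1)
  proof (cases rule: simple_term.cases)
    case simple_nohnf
    then have "clock_diff True s z (Suc d) = {}"
      using cbt_annot_has_hnf by (auto simp: clock_diff_def)
    then show ?thesis by simp
  next
    case (simple_hnf h)
    then obtain k where k: "(hstep_simple ^^ k) s h" using rtranclp_imp_relpowp[of hstep_simple] by blast
    then have h: "(hstep ^^ k) s h" by (rule relpowp_mono[rotated]) (rule hstep_simple_imp_hstep)
    obtain j hz m where z: "j \<le> k" "(hstep ^^ j) z hz" "is_hnf hz" "(beta ^^ m) h hz" "m + k \<le> n + j"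
      using hstep_relpowp_beta_relpowp[OF h simple_hnf(2) hyps(2)] k by blast
    let ?R = "if j = k then {} else {[]} :: nat list set" and ?D = "clock_diff False h hz (Suc d)"
    have D: "finite ?D" "card ?D \<le> m" using hnf[OF simple_hnf(2,3) z(4)] by auto
    have sub: "clock_diff True s z (Suc d) \<subseteq> ?R \<union> ?D"
      by (rule clock_diff_head[OF h simple_hnf(2) z(2,3)])
    have "card (clock_diff True s z (Suc d)) \<le> card (?R \<union> ?D)"
      using card_mono[OF _ sub] D by simp
    also have "\<dots> \<le> card ?R + card ?D" by (rule card_Un_le)
    \<comment> \<open>If \<open>j < k\<close>, then \<open>m < n\<close>, which leaves a step for
      the root position.\<close>
    also have "\<dots> \<le> n" using D(2) z(1,5) by auto
    finally show ?thesis using D finite_subset[OF sub] by simp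
  qed
  with hnf show ?case by blast
qed

text \<open>The bound \<open>n\<close> does not depend on the depth, so it limits every finite set
  of changed positions and thereby the whole set.\<close>

lemma simple_clocks_cofinitely_stable:
  assumes "simple_term s" "beta\<^sup>*\<^sup>* s z"
  shows "finite {p. \<exists>l k. cBT s p = Some (l, Some k) \<and> (\<forall>l'. cBT z p \<noteq> Some (l', Some k))}"
    (is "finite ?D")
proof -
  obtain n where n: "(beta ^^ n) s z" using rtranclp_imp_relpowp[OF assms(2)] by blast
  have "card G \<le> n" if G: "G \<subseteq> ?D" "finite G" for G
  proof -
    \<comment> \<open>\<open>Suc\<close> since \<open>clock_diff\<close> bounds lengths strictly. If
      \<open>G\<close> is empty, the inclusion holds whatever \<open>Max {}\<close> is.\<close>
    have "G \<subseteq> clock_diff True s z (Suc (Max (length ` G)))"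
      using G by (auto simp: clock_diff_def cBT_def less_Suc_eq_le)
    then show ?thesis using clock_diff_bound[of s n z] assms(1) n by (meson card_mono le_trans)
  qed
  then show ?thesis using finite_if_finite_subsets_card_bdd by blast
qed

theorem theorem6p11:
  fixes M N :: trm
  assumes "\<exists>M' N'. beta\<^sup>*\<^sup>* M M' \<and> simple_term M' \<and> beta\<^sup>*\<^sup>* N N' \<and> BT M' = BT N' \<and>
     infinite {p. \<exists>l1 l2 k1 k2. cBT M' p = Some (l1, Some k1) \<and> cBT N' p = Some (l2, Some k2)
                               \<and> k1 > k2}"
  shows "\<not> equivclp beta M N"
proof
  assume conv: "equivclp beta M N"
  from assms obtain M' N' where M': "beta\<^sup>*\<^sup>* M M'" "simple_term M'" and N': "beta\<^sup>*\<^sup>* N N'"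
    and inf: "infinite {p. \<exists>l1 l2 k1 k2. cBT M' p = Some (l1, Some k1) \<and>
      cBT N' p = Some (l2, Some k2) \<and> k1 > k2}" (is "infinite ?P")
    by blast
  have "equivclp beta M' N'"
    using equivclp_trans[OF equivclp_trans[OF equivclp_sym[OF rtranclp_into_equivclp[OF M'(1)]] conv]
      rtranclp_into_equivclp[OF N']] .
  then obtain Z where Z: "beta\<^sup>*\<^sup>* M' Z" "beta\<^sup>*\<^sup>* N' Z" using equivclp_beta_joinable by blast
  obtain n where n: "(beta ^^ n) N' Z" using rtranclp_imp_relpowp[OF Z(2)] by blast
  \<comment> \<open>At these positions the clock of \<open>Z\<close> is at most
    \<open>k2 < k1\<close>, hence not the clock \<open>k1\<close> of \<open>M'\<close>.\<close>
  have "?P \<subseteq> {p. \<exists>l k. cBT M' p = Some (l, Some k) \<and> (\<forall>l'. cBT Z p \<noteq> Some (l', Some k))}"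
    using cbt_accelerates[OF n, of True] by (fastforce simp: cBT_def)
  then show False
    using inf simple_clocks_cofinitely_stable[OF M'(2) Z(1)] finite_subset by blast
qed

end
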